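(* Consider the networked system with additional inputs $v\in\mathbb R^p$ and $r\in\mathbb R^{q_1+q_2}$, $$\Sigma:\quad \dot x=Ax+Bu+Rv,\qquad y=Cx+r,$$ $$A=\begin{bmatrix} A_1 & J_1S_2 \\ J_2S_1 & A_2 \end{bmatrix},\quad B=\begin{bmatrix} B_1 & 0 \\ 0 & B_2 \end{bmatrix},\quad C=\begin{bmatrix} C_1 & 0 \\ 0 & C_2 \end{bmatrix},$$ where $(A,R)$ is controllable, and let $z=[z_1^{\sf T},z_2^{\sf T}]^{\sf T}$ with $z_i=S_ix_i$. Let $\Theta$ be any matrix such that $A+R\Theta$ is Hurwitz, and let the compensator be $$\Phi:\quad \dot\phi=\Lambda\phi+\Gamma z,\qquad r=\Xi\phi,\qquad v=\Theta\phi,$$ $$\Lambda=\begin{bmatrix} A_1 & J_1S_2 \\ 0 & A_2 \end{bmatrix}+R\Theta,\quad \Gamma=\begin{bmatrix} 0 & 0 \\ J_2 & 0 \end{bmatrix},\quad \Xi=-\begin{bmatrix} C_1 & 0 \\ 0 & C_2 \end{bmatrix}.$$ Then the compensated system $\Sigma_\Phi:=(\Sigma,\Phi)$, i.e. the interconnection of $\Sigma$ and $\Phi$ with input $u$ and output $y$, is weakly resilient.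
   Context: The system $\Sigma$ is composed of two subsystems ($i,j\in\{1,2\}$, $j\neq i$) $$\Sigma_i:\quad \dot x_i=A_ix_i+J_iz_j+B_iu_i,\qquad z_i=S_ix_i,\qquad y_i=C_ix_i,$$ with $x_i\in\mathbb R^{n_i}$, $z_i\in\mathbb R^{p_i}$, $u_i\in\mathbb R^{m_i}$, $y_i\in\mathbb R^{q_i}$, and real matrices of compatible dimensions (that is, there is no direct term from $z_j$ to $y_i$). Here $x=[x_1^{\sf T},x_2^{\sf T}]^{\sf T}$, $u=[u_1^{\sf T},u_2^{\sf T}]^{\sf T}$, $y=[y_1^{\sf T},y_2^{\sf T}]^{\sf T}$, and $\phi\in\mathbb R^{n_1+n_2}$. The system $\Sigma$ is obtained from the interconnection of $\Sigma_1$ and $\Sigma_2$ by adding the inputs $v$ (to the state equation) and $r$ (to the output). A local controller $\kappa_i:y_i\mapsto u_i$ is a finite-dimensional linear time-invariant system given in state-space form, $\dot\xi_i=K_i\xi_i+H_iy_i$, $u_i=M_i\xi_i+N_iy_i$, of arbitrary finite state dimension. A closed-loop system is called stable if it is internally stable, i.e. the state matrix of its joint state-space model is Hurwitz. $(\Sigma_i,\kappa_i)$ is the local closed-loop system: the feedback interconnection of $\Sigma_i$ and $\kappa_i$ disconnected from the other subsystem (with $z_j$, $j\neq i$, regarded as an external input). The set of locally stabilizing controllers is $\mathcal K_i:=\{\kappa_i:(\Sigma_i,\kappa_i)\text{ is stable}\}$. The compensated system $\Sigma_\Phi$ (with state $(\phi,x)$, input $u=(u_1,u_2)$, output $y=(y_1,y_2)$)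 is weakly resilient if the closed-loop system $(\Sigma_\Phi,\{\kappa_i\})$ formed by connecting $\kappa_1$ and $\kappa_2$ to $\Sigma_\Phi$ is stable for every $\kappa_1\in\mathcal K_1$ and $\kappa_2\in\mathcal K_2$. *)

theory Defs
  imports Complex_Main "Jordan_Normal_Form.Char_Poly"
begin

(* Dimensions are natural numbers attached to matrices by carrier_mat, so that one formula can
   quantify over controllers of every finite state dimension, including 0 (static feedback). *)

definition hurwitz :: "real mat \<Rightarrow> bool" where
  "hurwitz A \<longleftrightarrow> (\<forall>s. eigenvalue (map_mat complex_of_real A) s \<longrightarrow> Re s < 0)"

(* x is a solution of x' = A x + R v on [0,T]; derivatives are one-sided at the end points. *)
definition trajectory ::
  "real mat \<Rightarrow> real mat \<Rightarrow> real \<Rightarrow> (real \<Rightarrow> real vec) \<Rightarrow> (real \<Rightarrow> real vec) \<Rightarrow> bool" where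
  "trajectory A R T v x \<longleftrightarrow>
     (\<forall>t\<in>{0..T}. x t \<in> carrier_vec (dim_row A) \<and>
        (\<forall>i<dim_row A. ((\<lambda>s. x s $ i) has_real_derivative (A *\<^sub>v x t + R *\<^sub>v v t) $ i)
                         (at t within {0..T})))"

definition controllable :: "real mat \<Rightarrow> real mat \<Rightarrow> bool" where
  "controllable A R \<longleftrightarrow>
     (\<forall>x0\<in>carrier_vec (dim_row A). \<forall>x1\<in>carrier_vec (dim_row A).
        \<exists>T>0. \<exists>v x.
          (\<forall>t\<in>{0..T}. v t \<in> carrier_vec (dim_col R)) \<and>
          (\<forall>k<dim_col R. continuous_on {0..T} (\<lambda>t. v t $ k)) \<and>
          trajectory A R T v x \<and> x 0 = x0 \<and> x T = x1)"

definition block_diag :: "real mat \<Rightarrow> real mat \<Rightarrow> real mat" where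
  "block_diag P Q =
     four_block_mat P (0\<^sub>m (dim_row P) (dim_col Q)) (0\<^sub>m (dim_row Q) (dim_col P)) Q"

(* The row [P, Q]; the blocks below it have no rows. *)
definition block_row :: "real mat \<Rightarrow> real mat \<Rightarrow> real mat" where
  "block_row P Q = four_block_mat P Q (0\<^sub>m 0 (dim_col P)) (0\<^sub>m 0 (dim_col Q))"

(* x' = A x + B u,  y = C x *)
record plant =
  plant_A :: "real mat"
  plant_B :: "real mat"
  plant_C :: "real mat"

(* x' = A x + J w + B u,  z = S x,  y = C x,  where w is the z-output of the other subsystem *)
record subsystem =
  sub_A :: "real mat"
  sub_J :: "real mat"
  sub_B :: "real mat"
  sub_S :: "real mat"
  sub_C :: "real mat"

(* x' = A x + B u + R v,  y = C x + r,  z = S x *)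
record network =
  net_A :: "real mat"
  net_B :: "real mat"
  net_R :: "real mat"
  net_C :: "real mat"
  net_S :: "real mat"

(* phi' = Lambda phi + Gamma z,  r = Xi phi,  v = Theta phi *)
record compensator =
  comp_Lambda :: "real mat"
  comp_Gamma :: "real mat"
  comp_Xi :: "real mat"
  comp_Theta :: "real mat"

(* xi' = K xi + H y,  u = M xi + N y *)
record controller =
  ctrl_K :: "real mat"
  ctrl_H :: "real mat"
  ctrl_M :: "real mat"
  ctrl_N :: "real mat"

(* q measured outputs, m control inputs, arbitrary state dimension d *)
definition is_controller :: "nat \<Rightarrow> nat \<Rightarrow> controller \<Rightarrow> bool" where
  "is_controller q m \<kappa> \<longleftrightarrow>
     (\<exists>d. ctrl_K \<kappa> \<in> carrier_mat d d \<and> ctrl_H \<kappa> \<in> carrier_mat d q \<and>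
          ctrl_M \<kappa> \<in> carrier_mat m d \<and> ctrl_N \<kappa> \<in> carrier_mat m q)"

(* State matrix for the joint state (x, xi): substitute y = C x and u = M xi + N y in
   x' = A x + B u and xi' = K xi + H y. *)
definition closed_loop :: "plant \<Rightarrow> controller \<Rightarrow> real mat" where
  "closed_loop P \<kappa> =
     four_block_mat
       (plant_A P + plant_B P * ctrl_N \<kappa> * plant_C P) (plant_B P * ctrl_M \<kappa>)
       (ctrl_H \<kappa> * plant_C P)                          (ctrl_K \<kappa>)"

(* The interconnection input only enters as an external signal and does not affect
   the state matrix of the local closed loop. *)
definition local_plant :: "subsystem \<Rightarrow> plant" where
  "local_plant \<Sigma> = \<lparr>plant_A = sub_A \<Sigma>, plant_B = sub_B \<Sigma>, plant_C = sub_C \<Sigma>\<rparr>"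

definition stabilizing_controllers :: "subsystem \<Rightarrow> controller set" where
  "stabilizing_controllers \<Sigma> =
     {\<kappa>. is_controller (dim_row (sub_C \<Sigma>)) (dim_col (sub_B \<Sigma>)) \<kappa> \<and>
          hurwitz (closed_loop (local_plant \<Sigma>) \<kappa>)}"

(* Two controllers acting separately, u1 from y1 and u2 from y2, seen as one controller
   from y = (y1, y2) to u = (u1, u2) with state (xi1, xi2). *)
definition parallel :: "controller \<Rightarrow> controller \<Rightarrow> controller" where
  "parallel \<kappa>1 \<kappa>2 =
     \<lparr>ctrl_K = block_diag (ctrl_K \<kappa>1) (ctrl_K \<kappa>2), ctrl_H = block_diag (ctrl_H \<kappa>1) (ctrl_H \<kappa>2),
      ctrl_M = block_diag (ctrl_M \<kappa>1) (ctrl_M \<kappa>2), ctrl_N = block_diag (ctrl_N \<kappa>1) (ctrl_N \<kappa>2)\<rparr>"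

(* State (phi, x), input u, output y: substitute z = S x, v = Theta phi, r = Xi phi to get
   phi' = Lambda phi + Gamma S x,  x' = R Theta phi + A x + B u,  y = Xi phi + C x. *)
definition compensated_system :: "network \<Rightarrow> compensator \<Rightarrow> plant" where
  "compensated_system \<Sigma> \<Phi> =
     \<lparr>plant_A = four_block_mat
                  (comp_Lambda \<Phi>)              (comp_Gamma \<Phi> * net_S \<Sigma>)
                  (net_R \<Sigma> * comp_Theta \<Phi>)  (net_A \<Sigma>),
      plant_B = 0\<^sub>m (dim_row (comp_Lambda \<Phi>)) (dim_col (net_B \<Sigma>)) @\<^sub>r net_B \<Sigma>,
      plant_C = block_row (comp_Xi \<Phi>) (net_C \<Sigma>)\<rparr>"

definition weakly_resilient :: "subsystem \<Rightarrow> subsystem \<Rightarrow> plant \<Rightarrow> bool" where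
  "weakly_resilient \<Sigma>1 \<Sigma>2 P \<longleftrightarrow>
     (\<forall>\<kappa>1\<in>stabilizing_controllers \<Sigma>1. \<forall>\<kappa>2\<in>stabilizing_controllers \<Sigma>2.
        hurwitz (closed_loop P (parallel \<kappa>1 \<kappa>2)))"

end

theory Submission
  imports Defs
begin

text \<open>
  In the coordinates e = x - phi the output is y = C e, and the compensator is chosen such that
  the coupling J2 S1 of the first subsystem into the second one cancels: e evolves with the state
  matrix [A1, J1 S2; 0, A2] and does not depend on phi, whereas phi evolves with A + R Theta and
  is driven by e. Hence the closed loop is a cascade: the local loop of (e2, xi2) drives the local
  loop of (e1, xi1), and both drive phi. Applied to an eigenvector of the closed loop with
  eigenvalue s, this says that the first nonzero one of (e2, xi2), (e1, xi1), phi is an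
  eigenvector with eigenvalue s of a matrix assumed to be Hurwitz.
\<close>

section \<open>Complexified real matrices acting on stacked vectors\<close>

abbreviation cmat :: "real mat \<Rightarrow> complex mat" where
  "cmat \<equiv> map_mat complex_of_real"

lemmas cmat_mult = of_real_hom.mat_hom_mult[where 'a = complex]

lemma cmat_add:
  "A \<in> carrier_mat m n \<Longrightarrow> B \<in> carrier_mat m n \<Longrightarrow> cmat (A + B) = cmat A + cmat B"
  by (intro eq_matI) auto

lemma cmat_uminus: "cmat (- A) = - cmat A"
  by (intro eq_matI) auto

lemma cmat_zero: "cmat (0\<^sub>m m n) = 0\<^sub>m m n"
  by (intro eq_matI) auto

lemma zero_mat_mult_vec:
  "v \<in> carrier_vec n \<Longrightarrow> (0\<^sub>m m n :: 'a :: semiring_0 mat) *\<^sub>v v = 0\<^sub>v m"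
  by (intro eq_vecI) auto

lemma mult_mat_zero_vec:
  "A \<in> carrier_mat m n \<Longrightarrow> (A :: 'a :: semiring_0 mat) *\<^sub>v 0\<^sub>v n = 0\<^sub>v m"
  by (intro eq_vecI) auto

lemma zero_append_zero: "0\<^sub>v n @\<^sub>v 0\<^sub>v m = 0\<^sub>v (n + m)"
  by (intro eq_vecI) auto

lemma smult_append_vec: "a \<cdot>\<^sub>v (v @\<^sub>v w) = (a \<cdot>\<^sub>v v) @\<^sub>v (a \<cdot>\<^sub>v w)"
  by (intro eq_vecI) auto

lemma carrier_vec_appendE:
  assumes "v \<in> carrier_vec (n + m)"
  obtains a b where "a \<in> carrier_vec n" "b \<in> carrier_vec m" "v = a @\<^sub>v b"
  using assms by (metis vec_first_last_append vec_first_carrier vec_last_carrier)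

lemma cmat_four_block_mult_vec:
  assumes "P \<in> carrier_mat nr1 nc1" "Q \<in> carrier_mat nr1 nc2"
    and "U \<in> carrier_mat nr2 nc1" "W \<in> carrier_mat nr2 nc2"
    and "a \<in> carrier_vec nc1" "b \<in> carrier_vec nc2"
  shows "cmat (four_block_mat P Q U W) *\<^sub>v (a @\<^sub>v b) =
    (cmat P *\<^sub>v a + cmat Q *\<^sub>v b) @\<^sub>v (cmat U *\<^sub>v a + cmat W *\<^sub>v b)"
  using assms
  by (simp add: map_four_block_mat[OF assms(1-4)] four_block_mat_mult_vec[of _ nr1 nc1 _ nc2 _ nr2])

lemma cmat_block_diag_mult_vec:
  assumes "P \<in> carrier_mat nr1 nc1" "Q \<in> carrier_mat nr2 nc2"
    and "a \<in> carrier_vec nc1" "b \<in> carrier_vec nc2"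
  shows "cmat (block_diag P Q) *\<^sub>v (a @\<^sub>v b) = (cmat P *\<^sub>v a) @\<^sub>v (cmat Q *\<^sub>v b)"
proof -
  have "cmat P *\<^sub>v a \<in> carrier_vec nr1" "cmat Q *\<^sub>v b \<in> carrier_vec nr2"
    using assms by auto
  then show ?thesis
    using assms unfolding block_diag_def
    by (simp add: cmat_four_block_mult_vec[of _ nr1 nc1 _ nc2 _ nr2] cmat_zero zero_mat_mult_vec
        left_zero_vec right_zero_vec)
qed

lemma cmat_block_row_mult_vec:
  assumes "P \<in> carrier_mat nr nc1" "Q \<in> carrier_mat nr nc2"
    and "a \<in> carrier_vec nc1" "b \<in> carrier_vec nc2"
  shows "cmat (block_row P Q) *\<^sub>v (a @\<^sub>v b) = cmat P *\<^sub>v a + cmat Q *\<^sub>v b"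
proof -
  have "cmat (block_row P Q) *\<^sub>v (a @\<^sub>v b) =
    (cmat P *\<^sub>v a + cmat Q *\<^sub>v b) @\<^sub>v
    (cmat (0\<^sub>m 0 nc1) *\<^sub>v a + cmat (0\<^sub>m 0 nc2) *\<^sub>v b)"
    using assms unfolding block_row_def
    by (simp add: cmat_four_block_mult_vec[of _ nr nc1 _ nc2 _ 0])
  \<comment> \<open>The appended lower part has dimension 0, so it contributes no entries.\<close>
  also have "\<dots> = cmat P *\<^sub>v a + cmat Q *\<^sub>v b"
    using assms by (intro eq_vecI) auto
  finally show ?thesis .
qed

section \<open>The Hurwitz property of closed loops in terms of modes\<close>

text \<open>Eigenvectors are nonzero, but a block of an eigenvector may vanish. Moving the case
  \<open>v = 0\<close> into the conclusion lets the criterion be applied directly to such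
  blocks.\<close>

lemma hurwitz_iff:
  assumes "A \<in> carrier_mat n n"
  shows "hurwitz A \<longleftrightarrow>
    (\<forall>s. \<forall>v\<in>carrier_vec n. cmat A *\<^sub>v v = s \<cdot>\<^sub>v v \<longrightarrow> v = 0\<^sub>v n \<or> Re s < 0)"
  using assms unfolding hurwitz_def eigenvalue_def eigenvector_def by auto

definition plant_dims :: "nat \<Rightarrow> nat \<Rightarrow> nat \<Rightarrow> plant \<Rightarrow> bool" where
  "plant_dims n m q P \<longleftrightarrow>
     plant_A P \<in> carrier_mat n n \<and> plant_B P \<in> carrier_mat n m \<and> plant_C P \<in> carrier_mat q n"

text \<open>The state dimension \<open>d\<close>, bound existentially in
  \<open>is_controller\<close>, becomes a parameter here, so that joint state vectors can be split
  at a known position.\<close>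

definition controller_dims :: "nat \<Rightarrow> nat \<Rightarrow> nat \<Rightarrow> controller \<Rightarrow> bool" where
  "controller_dims d q m \<kappa> \<longleftrightarrow>
     ctrl_K \<kappa> \<in> carrier_mat d d \<and> ctrl_H \<kappa> \<in> carrier_mat d q \<and>
     ctrl_M \<kappa> \<in> carrier_mat m d \<and> ctrl_N \<kappa> \<in> carrier_mat m q"

text \<open>The signals are complex because modes belong to complex eigenvalues. Keeping the input
  as one vector means that plant equations can be compared without expanding the controller
  gains.\<close>

definition ctrl_input :: "controller \<Rightarrow> complex vec \<Rightarrow> complex vec \<Rightarrow> complex vec" where
  "ctrl_input \<kappa> \<xi> y = cmat (ctrl_N \<kappa>) *\<^sub>v y + cmat (ctrl_M \<kappa>) *\<^sub>v \<xi>"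

(* (x, xi) times exp(s t) solves the closed-loop equations; x = 0, xi = 0 is allowed. *)
definition closed_loop_mode ::
  "plant \<Rightarrow> controller \<Rightarrow> complex \<Rightarrow> complex vec \<Rightarrow> complex vec \<Rightarrow> bool" where
  "closed_loop_mode P \<kappa> s x \<xi> \<longleftrightarrow>
     cmat (plant_A P) *\<^sub>v x + cmat (plant_B P) *\<^sub>v ctrl_input \<kappa> \<xi> (cmat (plant_C P) *\<^sub>v x)
       = s \<cdot>\<^sub>v x \<and>
     cmat (ctrl_H \<kappa>) *\<^sub>v (cmat (plant_C P) *\<^sub>v x) + cmat (ctrl_K \<kappa>) *\<^sub>v \<xi> = s \<cdot>\<^sub>v \<xi>"

lemma ctrl_input_carrier:
  assumes "controller_dims d q m \<kappa>"
  shows "ctrl_input \<kappa> \<xi> y \<in> carrier_vec m"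
  using assms unfolding controller_dims_def ctrl_input_def by (intro carrier_vecI) auto

text \<open>Reassociating the products in the state matrix, e.g. \<open>B * N * C\<close> applied to
  \<open>x\<close>, recovers the signals \<open>y\<close> and \<open>u\<close>. An eigenvector
  equation then separates into a plant part and a controller part, and later arguments manipulate
  these signals instead of block matrices.\<close>

lemma hurwitz_closed_loop_iff:
  assumes P: "plant_dims n m q P" and \<kappa>: "controller_dims d q m \<kappa>"
  shows "hurwitz (closed_loop P \<kappa>) \<longleftrightarrow>
    (\<forall>s. \<forall>x\<in>carrier_vec n. \<forall>\<xi>\<in>carrier_vec d.
       closed_loop_mode P \<kappa> s x \<xi> \<longrightarrow> (x = 0\<^sub>v n \<and> \<xi> = 0\<^sub>v d) \<or> Re s < 0)"
proof -
  have mats: "plant_A P \<in> carrier_mat n n" "plant_B P \<in> carrier_mat n m"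
    "plant_C P \<in> carrier_mat q n" "ctrl_K \<kappa> \<in> carrier_mat d d" "ctrl_H \<kappa> \<in> carrier_mat d q"
    "ctrl_M \<kappa> \<in> carrier_mat m d" "ctrl_N \<kappa> \<in> carrier_mat m q"
    using assms unfolding plant_dims_def controller_dims_def by auto
  have L: "closed_loop P \<kappa> \<in> carrier_mat (n + d) (n + d)"
    using mats unfolding closed_loop_def by auto
  have mode: "cmat (closed_loop P \<kappa>) *\<^sub>v (x @\<^sub>v \<xi>) = s \<cdot>\<^sub>v (x @\<^sub>v \<xi>) \<longleftrightarrow>
      closed_loop_mode P \<kappa> s x \<xi>"
    if x: "x \<in> carrier_vec n" and \<xi>: "\<xi> \<in> carrier_vec d" for s x \<xi>
  proof -
    let ?A = "cmat (plant_A P)" and ?B = "cmat (plant_B P)" and ?C = "cmat (plant_C P)"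
    let ?H = "cmat (ctrl_H \<kappa>)" and ?K = "cmat (ctrl_K \<kappa>)"
    let ?M = "cmat (ctrl_M \<kappa>)" and ?N = "cmat (ctrl_N \<kappa>)"
    have cm: "?A \<in> carrier_mat n n" "?B \<in> carrier_mat n m" "?C \<in> carrier_mat q n"
      "?K \<in> carrier_mat d d" "?H \<in> carrier_mat d q" "?M \<in> carrier_mat m d" "?N \<in> carrier_mat m q"
      using mats by auto
    have Cx: "?C *\<^sub>v x \<in> carrier_vec q" and NCx: "?N *\<^sub>v (?C *\<^sub>v x) \<in> carrier_vec m"
      and M\<xi>: "?M *\<^sub>v \<xi> \<in> carrier_vec m"
      using cm x \<xi> by auto
    have BN: "plant_B P * ctrl_N \<kappa> \<in> carrier_mat n q"
      and BNC: "plant_B P * ctrl_N \<kappa> * plant_C P \<in> carrier_mat n n"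
      and BM: "plant_B P * ctrl_M \<kappa> \<in> carrier_mat n d"
      and HC: "ctrl_H \<kappa> * plant_C P \<in> carrier_mat d n"
      using mats by auto
    have hom: "cmat (plant_B P * ctrl_N \<kappa> * plant_C P) = ?B * ?N * ?C"
      "cmat (plant_B P * ctrl_M \<kappa>) = ?B * ?M" "cmat (ctrl_H \<kappa> * plant_C P) = ?H * ?C"
      by (simp_all add: cmat_mult[OF BN mats(3)] cmat_mult[OF mats(2) mats(7)]
          cmat_mult[OF mats(2) mats(6)] cmat_mult[OF mats(5) mats(3)])
    have BNCx: "?B * ?N * ?C *\<^sub>v x = ?B *\<^sub>v (?N *\<^sub>v (?C *\<^sub>v x))"
      using assoc_mult_mat_vec[OF mult_carrier_mat[OF cm(2,7)] cm(3) x]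
        assoc_mult_mat_vec[OF cm(2,7) Cx] by simp
    have "cmat (closed_loop P \<kappa>) *\<^sub>v (x @\<^sub>v \<xi>) =
      (cmat (plant_A P + plant_B P * ctrl_N \<kappa> * plant_C P) *\<^sub>v x
        + cmat (plant_B P * ctrl_M \<kappa>) *\<^sub>v \<xi>) @\<^sub>v
      (cmat (ctrl_H \<kappa> * plant_C P) *\<^sub>v x + ?K *\<^sub>v \<xi>)"
      unfolding closed_loop_def
      by (rule cmat_four_block_mult_vec[OF add_carrier_mat[OF BNC] BM HC mats(4) x \<xi>])
    also have "cmat (plant_A P + plant_B P * ctrl_N \<kappa> * plant_C P) *\<^sub>v x =
        ?A *\<^sub>v x + ?B *\<^sub>v (?N *\<^sub>v (?C *\<^sub>v x))"
      unfolding cmat_add[OF mats(1) BNC] hom BNCx[symmetric]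
      using cm by (intro add_mult_distrib_mat_vec[of _ n n] x) auto
    also have "cmat (plant_B P * ctrl_M \<kappa>) *\<^sub>v \<xi> = ?B *\<^sub>v (?M *\<^sub>v \<xi>)"
      unfolding hom by (rule assoc_mult_mat_vec[OF cm(2,6) \<xi>])
    also have "cmat (ctrl_H \<kappa> * plant_C P) *\<^sub>v x = ?H *\<^sub>v (?C *\<^sub>v x)"
      unfolding hom by (rule assoc_mult_mat_vec[OF cm(5,3) x])
    also have "?A *\<^sub>v x + ?B *\<^sub>v (?N *\<^sub>v (?C *\<^sub>v x)) + ?B *\<^sub>v (?M *\<^sub>v \<xi>) =
        ?A *\<^sub>v x + ?B *\<^sub>v ctrl_input \<kappa> \<xi> (?C *\<^sub>v x)"
      unfolding ctrl_input_def mult_add_distrib_mat_vec[OF cm(2) NCx M\<xi>]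
      using cm x \<xi> by (intro assoc_add_vec[of _ n]) auto
    finally have eq: "cmat (closed_loop P \<kappa>) *\<^sub>v (x @\<^sub>v \<xi>) =
      (?A *\<^sub>v x + ?B *\<^sub>v ctrl_input \<kappa> \<xi> (?C *\<^sub>v x)) @\<^sub>v
      (?H *\<^sub>v (?C *\<^sub>v x) + ?K *\<^sub>v \<xi>)" .
    have "?A *\<^sub>v x + ?B *\<^sub>v ctrl_input \<kappa> \<xi> (?C *\<^sub>v x) \<in> carrier_vec n"
      using cm by (intro carrier_vecI) auto
    then show ?thesis
      unfolding eq smult_append_vec closed_loop_mode_def
      using x by (subst append_vec_eq[of _ n]) auto
  qed
  \<comment> \<open>Vectors of dimension \<open>n + d\<close> are exactly the pairs
    \<open>x @\<^sub>v \<xi>\<close>, and such a pair is zero iff both parts are.\<close>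
  show ?thesis
    unfolding hurwitz_iff[OF L] all_vec_append
    by (auto simp: mode zero_append_zero[symmetric] append_vec_eq[of _ n])
qed

section \<open>Separation of the compensated loop into error and compensator dynamics\<close>

text \<open>In the application \<open>G\<close> is \<open>\<Gamma> * S\<close>, \<open>F\<close> is
  \<open>R * \<Theta>\<close>, and \<open>D\<close> is \<open>A\<close> without the coupling
  \<open>J2 * S1\<close>. Only the pattern of these blocks matters: both block rows contain the same
  \<open>F\<close> acting on \<phi> and the same \<open>G\<close> acting on \<open>x\<close>, so
  both terms cancel in the difference of the rows. Neither a structure of \<open>D\<close> nor a
  splitting of the controller enters.\<close>

lemma hurwitz_compensated_closed_loop:
  assumes D: "D \<in> carrier_mat n n" and G: "G \<in> carrier_mat n n" and F: "F \<in> carrier_mat n n"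
    and B: "B \<in> carrier_mat n m" and C: "C \<in> carrier_mat q n"
    and \<kappa>: "controller_dims d q m \<kappa>"
    and state: "hurwitz (D + G + F)"
    and error: "hurwitz (closed_loop \<lparr>plant_A = D, plant_B = B, plant_C = C\<rparr> \<kappa>)"
  shows "hurwitz (closed_loop
    \<lparr>plant_A = four_block_mat (D + F) G F (D + G),
     plant_B = 0\<^sub>m n m @\<^sub>r B, plant_C = block_row (- C) C\<rparr> \<kappa>)"
    (is "hurwitz (closed_loop ?P \<kappa>)")
proof -
  let ?E = "\<lparr>plant_A = D, plant_B = B, plant_C = C\<rparr>"
  have E: "plant_dims n m q ?E"
    using D B C by (simp add: plant_dims_def)
  have P: "plant_dims (n + n) m q ?P"
    using assms by (auto simp: plant_dims_def block_row_def)
  have goal: "(v = 0\<^sub>v (n + n) \<and> \<xi> = 0\<^sub>v d) \<or> Re s < 0"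
    if v: "v \<in> carrier_vec (n + n)" and \<xi>: "\<xi> \<in> carrier_vec d"
      and mode: "closed_loop_mode ?P \<kappa> s v \<xi>" for s v \<xi>
  proof -
    obtain \<phi> x where \<phi>: "\<phi> \<in> carrier_vec n" and x: "x \<in> carrier_vec n" and v_eq: "v = \<phi> @\<^sub>v x"
      using v by (rule carrier_vec_appendE)
    define e where "e = x - \<phi>"
    have e: "e \<in> carrier_vec n" using \<phi> x by (simp add: e_def)
    \<comment> \<open>The controller sees \<phi> and \<open>x\<close> only through their
      difference.\<close>
    have Ce: "cmat (block_row (- C) C) *\<^sub>v v = cmat C *\<^sub>v e"
    proof -
      have "cmat (block_row (- C) C) *\<^sub>v v = - (cmat C *\<^sub>v \<phi>) + cmat C *\<^sub>v x"
        unfolding v_eq using C \<phi> x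
        by (simp add: cmat_block_row_mult_vec[of _ q n _ n] cmat_uminus)
      also have "\<dots> = cmat C *\<^sub>v e"
        unfolding e_def using C \<phi> x
        by (subst mult_minus_distrib_mat_vec[of _ q n]) auto
      finally show ?thesis .
    qed
    \<comment> \<open>As the measured output is \<open>C e\<close>, this is at once the input of the
      compensated plant and that of the error plant \<open>?E\<close>.\<close>
    define u where "u = ctrl_input \<kappa> \<xi> (cmat C *\<^sub>v e)"
    have u: "u \<in> carrier_vec m" unfolding u_def by (rule ctrl_input_carrier[OF \<kappa>])
    have Bu: "cmat (0\<^sub>m n m @\<^sub>r B) *\<^sub>v u = 0\<^sub>v n @\<^sub>v (cmat B *\<^sub>v u)"
    proof -
      have "cmat (0\<^sub>m n m @\<^sub>r B) = 0\<^sub>m n m @\<^sub>r cmat B"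
        using B by (intro eq_matI) (auto simp: append_rows_def)
      then show ?thesis
        using B u by (simp add: mat_mult_append[of _ n m _ n] zero_mat_mult_vec)
    qed
    have Av: "cmat (four_block_mat (D + F) G F (D + G)) *\<^sub>v v =
      (cmat D *\<^sub>v \<phi> + cmat F *\<^sub>v \<phi> + cmat G *\<^sub>v x) @\<^sub>v
      (cmat F *\<^sub>v \<phi> + (cmat D *\<^sub>v x + cmat G *\<^sub>v x))"
      unfolding v_eq using D G F \<phi> x
      by (simp add: cmat_four_block_mult_vec[of _ n n _ n _ n] cmat_add[of _ n n]
          add_mult_distrib_mat_vec[of _ n n])
    have cs: "cmat D *\<^sub>v \<phi> \<in> carrier_vec n" "cmat D *\<^sub>v x \<in> carrier_vec n"
      "cmat F *\<^sub>v \<phi> \<in> carrier_vec n" "cmat G *\<^sub>v \<phi> \<in> carrier_vec n"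
      "cmat G *\<^sub>v x \<in> carrier_vec n" "cmat B *\<^sub>v u \<in> carrier_vec n"
      using D F G B \<phi> x u by auto
    have eqs: "cmat D *\<^sub>v \<phi> + cmat F *\<^sub>v \<phi> + cmat G *\<^sub>v x = s \<cdot>\<^sub>v \<phi>"
      "cmat F *\<^sub>v \<phi> + (cmat D *\<^sub>v x + cmat G *\<^sub>v x) + cmat B *\<^sub>v u = s \<cdot>\<^sub>v x"
      and ctrl: "cmat (ctrl_H \<kappa>) *\<^sub>v (cmat C *\<^sub>v e) + cmat (ctrl_K \<kappa>) *\<^sub>v \<xi> = s \<cdot>\<^sub>v \<xi>"
    proof -
      have "cmat (four_block_mat (D + F) G F (D + G)) *\<^sub>v v + cmat (0\<^sub>m n m @\<^sub>r B) *\<^sub>v u = s \<cdot>\<^sub>v v"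
        and *: "cmat (ctrl_H \<kappa>) *\<^sub>v (cmat C *\<^sub>v e) + cmat (ctrl_K \<kappa>) *\<^sub>v \<xi> = s \<cdot>\<^sub>v \<xi>"
        using mode by (simp_all add: closed_loop_mode_def Ce u_def)
      then have "(cmat D *\<^sub>v \<phi> + cmat F *\<^sub>v \<phi> + cmat G *\<^sub>v x) @\<^sub>v
          (cmat F *\<^sub>v \<phi> + (cmat D *\<^sub>v x + cmat G *\<^sub>v x) + cmat B *\<^sub>v u) =
          (s \<cdot>\<^sub>v \<phi>) @\<^sub>v (s \<cdot>\<^sub>v x)"
        unfolding Av Bu using cs
        by (subst (asm) append_vec_add[of _ n _ _ n]) (auto simp: v_eq smult_append_vec)
      then show "cmat D *\<^sub>v \<phi> + cmat F *\<^sub>v \<phi> + cmat G *\<^sub>v x = s \<cdot>\<^sub>v \<phi>"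
        "cmat F *\<^sub>v \<phi> + (cmat D *\<^sub>v x + cmat G *\<^sub>v x) + cmat B *\<^sub>v u = s \<cdot>\<^sub>v x"
        using cs \<phi> by (subst (asm) append_vec_eq[of _ n]; auto)+
      show "cmat (ctrl_H \<kappa>) *\<^sub>v (cmat C *\<^sub>v e) + cmat (ctrl_K \<kappa>) *\<^sub>v \<xi> = s \<cdot>\<^sub>v \<xi>"
        by (rule *)
    qed
    have De: "cmat D *\<^sub>v e = cmat D *\<^sub>v x - cmat D *\<^sub>v \<phi>"
      unfolding e_def using D \<phi> x by (intro mult_minus_distrib_mat_vec[of _ n n]) auto
    \<comment> \<open>Subtract the first equation of \<open>eqs\<close> from the second. The
      calculation is done entry by entry, with the entries of the matrix-vector products treated as
      atoms, so that it becomes arithmetic in the complex numbers.\<close>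
    have "cmat D *\<^sub>v e + cmat B *\<^sub>v u = s \<cdot>\<^sub>v e"
    proof (rule eq_vecI)
      fix i assume "i < dim_vec (s \<cdot>\<^sub>v e)"
      then have i: "i < n" using e by simp
      have 1: "(cmat D *\<^sub>v \<phi>) $ i + (cmat F *\<^sub>v \<phi>) $ i + (cmat G *\<^sub>v x) $ i = s * \<phi> $ i"
        using arg_cong[OF eqs(1), of "\<lambda>w. w $ i"] i D F G B \<phi> by (simp del: index_mult_mat_vec)
      have 2: "(cmat F *\<^sub>v \<phi>) $ i + ((cmat D *\<^sub>v x) $ i + (cmat G *\<^sub>v x) $ i) + (cmat B *\<^sub>v u) $ i
          = s * x $ i"
        using arg_cong[OF eqs(2), of "\<lambda>w. w $ i"] i D F G B x by (simp del: index_mult_mat_vec)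
      have "(cmat D *\<^sub>v e + cmat B *\<^sub>v u) $ i =
          (cmat D *\<^sub>v x) $ i - (cmat D *\<^sub>v \<phi>) $ i + (cmat B *\<^sub>v u) $ i"
        unfolding De using i D B by (simp del: index_mult_mat_vec)
      also have "\<dots> = s * x $ i - s * \<phi> $ i"
        unfolding 1[symmetric] 2[symmetric] by simp
      also have "\<dots> = (s \<cdot>\<^sub>v e) $ i"
        unfolding e_def using i x \<phi> by (simp add: right_diff_distrib)
      finally show "(cmat D *\<^sub>v e + cmat B *\<^sub>v u) $ i = (s \<cdot>\<^sub>v e) $ i" .
    qed (use B e in auto)
    then have "closed_loop_mode ?E \<kappa> s e \<xi>"
      using ctrl by (simp add: closed_loop_mode_def u_def)
    then have cases: "(e = 0\<^sub>v n \<and> \<xi> = 0\<^sub>v d) \<or> Re s < 0"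
      using error e \<xi> unfolding hurwitz_closed_loop_iff[OF E \<kappa>] by blast
    show ?thesis
    proof (cases "Re s < 0")
      case False
      then have e0: "e = 0\<^sub>v n" and \<xi>0: "\<xi> = 0\<^sub>v d" using cases by auto
      have x\<phi>: "x = \<phi>"
      proof (rule eq_vecI)
        fix i assume "i < dim_vec \<phi>"
        then show "x $ i = \<phi> $ i"
          using arg_cong[OF e0, of "\<lambda>w. w $ i"] x \<phi> by (simp add: e_def)
      qed (use x \<phi> in auto)
      \<comment> \<open>With \<open>x = \<phi>\<close>, the term \<open>G x\<close> of the
        compensator equation becomes \<open>G \<phi>\<close>, so all three matrices act on the same
        vector and \<phi> satisfies the eigenvector equation of \<open>D + G + F\<close>.\<close>
      have "cmat (D + G + F) *\<^sub>v \<phi> = cmat D *\<^sub>v \<phi> + cmat G *\<^sub>v \<phi> + cmat F *\<^sub>v \<phi>"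
        using D G F \<phi>
          by (simp add: cmat_add[of _ n n] add_mult_distrib_mat_vec[of _ n n]
              del: assoc_add_mat assoc_add_vec)
      also have "\<dots> = cmat D *\<^sub>v \<phi> + cmat F *\<^sub>v \<phi> + cmat G *\<^sub>v \<phi>"
        using D G F by (intro eq_vecI) (auto simp del: index_mult_mat_vec)
      finally have "cmat (D + G + F) *\<^sub>v \<phi> = s \<cdot>\<^sub>v \<phi>"
        using eqs(1) x\<phi> by simp
      moreover have "D + G + F \<in> carrier_mat n n" using D G F by simp
      ultimately have "\<phi> = 0\<^sub>v n"
        using state \<phi> False hurwitz_iff by blast
      then show ?thesis
        using x\<phi> \<xi>0 by (simp add: v_eq zero_append_zero)
    qed simp
  qed
  then show ?thesis
    unfolding hurwitz_closed_loop_iff[OF P \<kappa>] by blast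
qed

section \<open>Two local controllers on a block triangular plant\<close>

lemma parallel_dims:
  assumes "controller_dims d1 q1 m1 \<kappa>1" "controller_dims d2 q2 m2 \<kappa>2"
  shows "controller_dims (d1 + d2) (q1 + q2) (m1 + m2) (parallel \<kappa>1 \<kappa>2)"
  using assms by (auto simp: controller_dims_def parallel_def block_diag_def)

lemma ctrl_input_parallel:
  assumes \<kappa>1: "controller_dims d1 q1 m1 \<kappa>1" and \<kappa>2: "controller_dims d2 q2 m2 \<kappa>2"
    and "\<xi>1 \<in> carrier_vec d1" "\<xi>2 \<in> carrier_vec d2" "y1 \<in> carrier_vec q1" "y2 \<in> carrier_vec q2"
  shows "ctrl_input (parallel \<kappa>1 \<kappa>2) (\<xi>1 @\<^sub>v \<xi>2) (y1 @\<^sub>v y2) =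
    ctrl_input \<kappa>1 \<xi>1 y1 @\<^sub>v ctrl_input \<kappa>2 \<xi>2 y2"
proof -
  have m: "ctrl_M \<kappa>1 \<in> carrier_mat m1 d1" "ctrl_N \<kappa>1 \<in> carrier_mat m1 q1"
    "ctrl_M \<kappa>2 \<in> carrier_mat m2 d2" "ctrl_N \<kappa>2 \<in> carrier_mat m2 q2"
    using \<kappa>1 \<kappa>2 by (auto simp: controller_dims_def)
  have "cmat (ctrl_N \<kappa>1) *\<^sub>v y1 \<in> carrier_vec m1" "cmat (ctrl_M \<kappa>1) *\<^sub>v \<xi>1 \<in> carrier_vec m1"
    "cmat (ctrl_N \<kappa>2) *\<^sub>v y2 \<in> carrier_vec m2" "cmat (ctrl_M \<kappa>2) *\<^sub>v \<xi>2 \<in> carrier_vec m2"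
    using m assms by auto
  then show ?thesis
    unfolding ctrl_input_def
    by (simp add: parallel_def cmat_block_diag_mult_vec[OF m(1,3) assms(3,4)]
        cmat_block_diag_mult_vec[OF m(2,4) assms(5,6)] append_vec_add[of _ m1 _ _ m2])
qed

text \<open>The second loop receives nothing from the first, so the spectrum is governed by the two
  local loops, whatever the coupling \<open>W\<close>. The joint state is ordered
  \<open>(x1, x2, \<xi>1, \<xi>2)\<close>, so the state matrix is block triangular only after a
  permutation; arguing with modes avoids this reordering.\<close>

lemma hurwitz_cascade_closed_loop:
  assumes A1: "A1 \<in> carrier_mat n1 n1" and W: "W \<in> carrier_mat n1 n2"
    and A2: "A2 \<in> carrier_mat n2 n2"
    and B1: "B1 \<in> carrier_mat n1 m1" and B2: "B2 \<in> carrier_mat n2 m2"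
    and C1: "C1 \<in> carrier_mat q1 n1" and C2: "C2 \<in> carrier_mat q2 n2"
    and \<kappa>1: "controller_dims d1 q1 m1 \<kappa>1" and \<kappa>2: "controller_dims d2 q2 m2 \<kappa>2"
    and hurwitz1: "hurwitz (closed_loop \<lparr>plant_A = A1, plant_B = B1, plant_C = C1\<rparr> \<kappa>1)"
    and hurwitz2: "hurwitz (closed_loop \<lparr>plant_A = A2, plant_B = B2, plant_C = C2\<rparr> \<kappa>2)"
  shows "hurwitz (closed_loop
    \<lparr>plant_A = four_block_mat A1 W (0\<^sub>m n2 n1) A2,
     plant_B = block_diag B1 B2, plant_C = block_diag C1 C2\<rparr> (parallel \<kappa>1 \<kappa>2))"
    (is "hurwitz (closed_loop ?P ?\<kappa>)")
proof -
  let ?P1 = "\<lparr>plant_A = A1, plant_B = B1, plant_C = C1\<rparr>"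
  let ?P2 = "\<lparr>plant_A = A2, plant_B = B2, plant_C = C2\<rparr>"
  have P1: "plant_dims n1 m1 q1 ?P1" and P2: "plant_dims n2 m2 q2 ?P2"
    and P: "plant_dims (n1 + n2) (m1 + m2) (q1 + q2) ?P"
    using assms by (auto simp: plant_dims_def block_diag_def)
  note \<kappa> = parallel_dims[OF \<kappa>1 \<kappa>2]
  have k: "ctrl_K \<kappa>1 \<in> carrier_mat d1 d1" "ctrl_H \<kappa>1 \<in> carrier_mat d1 q1"
    "ctrl_K \<kappa>2 \<in> carrier_mat d2 d2" "ctrl_H \<kappa>2 \<in> carrier_mat d2 q2"
    using \<kappa>1 \<kappa>2 by (auto simp: controller_dims_def)
  have goal: "(x = 0\<^sub>v (n1 + n2) \<and> \<xi> = 0\<^sub>v (d1 + d2)) \<or> Re s < 0"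
    if x: "x \<in> carrier_vec (n1 + n2)" and \<xi>: "\<xi> \<in> carrier_vec (d1 + d2)"
      and mode: "closed_loop_mode ?P ?\<kappa> s x \<xi>" for s x \<xi>
  proof -
    obtain x1 x2 where x1: "x1 \<in> carrier_vec n1" and x2: "x2 \<in> carrier_vec n2"
      and x_eq: "x = x1 @\<^sub>v x2"
      using x by (rule carrier_vec_appendE)
    obtain \<xi>1 \<xi>2 where \<xi>1: "\<xi>1 \<in> carrier_vec d1" and \<xi>2: "\<xi>2 \<in> carrier_vec d2"
      and \<xi>_eq: "\<xi> = \<xi>1 @\<^sub>v \<xi>2"
      using \<xi> by (rule carrier_vec_appendE)
    define y1 y2 where "y1 = cmat C1 *\<^sub>v x1" and "y2 = cmat C2 *\<^sub>v x2"
    define u1 u2 where "u1 = ctrl_input \<kappa>1 \<xi>1 y1" and "u2 = ctrl_input \<kappa>2 \<xi>2 y2"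
    have y1: "y1 \<in> carrier_vec q1" and y2: "y2 \<in> carrier_vec q2"
      using C1 C2 x1 x2 by (auto simp: y1_def y2_def)
    have u1: "u1 \<in> carrier_vec m1" and u2: "u2 \<in> carrier_vec m2"
      unfolding u1_def u2_def by (rule ctrl_input_carrier[OF \<kappa>1], rule ctrl_input_carrier[OF \<kappa>2])
    have y: "cmat (block_diag C1 C2) *\<^sub>v x = y1 @\<^sub>v y2"
      unfolding x_eq y1_def y2_def by (rule cmat_block_diag_mult_vec[OF C1 C2 x1 x2])
    have u: "ctrl_input ?\<kappa> \<xi> (y1 @\<^sub>v y2) = u1 @\<^sub>v u2"
      unfolding \<xi>_eq u1_def u2_def by (rule ctrl_input_parallel[OF \<kappa>1 \<kappa>2 \<xi>1 \<xi>2 y1 y2])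
    have Bu: "cmat (block_diag B1 B2) *\<^sub>v (u1 @\<^sub>v u2) = (cmat B1 *\<^sub>v u1) @\<^sub>v (cmat B2 *\<^sub>v u2)"
      by (rule cmat_block_diag_mult_vec[OF B1 B2 u1 u2])
    have cs: "cmat A1 *\<^sub>v x1 \<in> carrier_vec n1" "cmat W *\<^sub>v x2 \<in> carrier_vec n1"
      "cmat A2 *\<^sub>v x2 \<in> carrier_vec n2" "cmat B1 *\<^sub>v u1 \<in> carrier_vec n1"
      "cmat B2 *\<^sub>v u2 \<in> carrier_vec n2" "cmat (ctrl_H \<kappa>1) *\<^sub>v y1 \<in> carrier_vec d1"
      "cmat (ctrl_H \<kappa>2) *\<^sub>v y2 \<in> carrier_vec d2" "cmat (ctrl_K \<kappa>1) *\<^sub>v \<xi>1 \<in> carrier_vec d1"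
      "cmat (ctrl_K \<kappa>2) *\<^sub>v \<xi>2 \<in> carrier_vec d2"
      using assms k x1 x2 u1 u2 y1 y2 \<xi>1 \<xi>2 by auto
    have Ax: "cmat (four_block_mat A1 W (0\<^sub>m n2 n1) A2) *\<^sub>v x =
        (cmat A1 *\<^sub>v x1 + cmat W *\<^sub>v x2) @\<^sub>v (cmat A2 *\<^sub>v x2)"
      unfolding x_eq cmat_four_block_mult_vec[OF A1 W zero_carrier_mat A2 x1 x2]
      using cs x1 by (simp add: cmat_zero zero_mat_mult_vec)
    have H: "cmat (ctrl_H ?\<kappa>) *\<^sub>v (y1 @\<^sub>v y2) =
        (cmat (ctrl_H \<kappa>1) *\<^sub>v y1) @\<^sub>v (cmat (ctrl_H \<kappa>2) *\<^sub>v y2)"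
      by (simp add: parallel_def cmat_block_diag_mult_vec[OF k(2,4) y1 y2])
    have K: "cmat (ctrl_K ?\<kappa>) *\<^sub>v \<xi> =
        (cmat (ctrl_K \<kappa>1) *\<^sub>v \<xi>1) @\<^sub>v (cmat (ctrl_K \<kappa>2) *\<^sub>v \<xi>2)"
      by (simp add: parallel_def \<xi>_eq cmat_block_diag_mult_vec[OF k(1,3) \<xi>1 \<xi>2])
    have "((cmat A1 *\<^sub>v x1 + cmat W *\<^sub>v x2) @\<^sub>v (cmat A2 *\<^sub>v x2)) +
        ((cmat B1 *\<^sub>v u1) @\<^sub>v (cmat B2 *\<^sub>v u2)) = s \<cdot>\<^sub>v x"
      and "((cmat (ctrl_H \<kappa>1) *\<^sub>v y1) @\<^sub>v (cmat (ctrl_H \<kappa>2) *\<^sub>v y2)) +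
        ((cmat (ctrl_K \<kappa>1) *\<^sub>v \<xi>1) @\<^sub>v (cmat (ctrl_K \<kappa>2) *\<^sub>v \<xi>2)) = s \<cdot>\<^sub>v \<xi>"
      using mode by (simp_all add: closed_loop_mode_def y u Bu Ax H K)
    then have eqs: "cmat A1 *\<^sub>v x1 + cmat W *\<^sub>v x2 + cmat B1 *\<^sub>v u1 = s \<cdot>\<^sub>v x1"
      "cmat A2 *\<^sub>v x2 + cmat B2 *\<^sub>v u2 = s \<cdot>\<^sub>v x2"
      "cmat (ctrl_H \<kappa>1) *\<^sub>v y1 + cmat (ctrl_K \<kappa>1) *\<^sub>v \<xi>1 = s \<cdot>\<^sub>v \<xi>1"
      "cmat (ctrl_H \<kappa>2) *\<^sub>v y2 + cmat (ctrl_K \<kappa>2) *\<^sub>v \<xi>2 = s \<cdot>\<^sub>v \<xi>2"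
      unfolding x_eq \<xi>_eq smult_append_vec using cs x1 \<xi>1
      by (simp_all add: append_vec_add[of _ n1 _ _ n2] append_vec_add[of _ d1 _ _ d2]
          append_vec_eq[of _ n1] append_vec_eq[of _ d1])
    \<comment> \<open>The zero block below the diagonal keeps every signal of the first loop out of
      these equations.\<close>
    have "closed_loop_mode ?P2 \<kappa>2 s x2 \<xi>2"
      using eqs by (simp add: closed_loop_mode_def y2_def u2_def)
    then have cases2: "(x2 = 0\<^sub>v n2 \<and> \<xi>2 = 0\<^sub>v d2) \<or> Re s < 0"
      using hurwitz2 x2 \<xi>2 unfolding hurwitz_closed_loop_iff[OF P2 \<kappa>2] by blast
    show ?thesis
    proof (cases "Re s < 0")
      case False
      then have 0: "x2 = 0\<^sub>v n2" "\<xi>2 = 0\<^sub>v d2" using cases2 by auto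
      \<comment> \<open>Once \<open>x2\<close> vanishes, so does the only term that distinguishes
        the first pair of equations from a mode of the first local loop.\<close>
      have "cmat W *\<^sub>v x2 = 0\<^sub>v n1"
        unfolding 0 using W by (intro mult_mat_zero_vec) auto
      then have "closed_loop_mode ?P1 \<kappa>1 s x1 \<xi>1"
        using eqs cs by (simp add: closed_loop_mode_def y1_def u1_def)
      then have "x1 = 0\<^sub>v n1 \<and> \<xi>1 = 0\<^sub>v d1"
        using hurwitz1 x1 \<xi>1 False unfolding hurwitz_closed_loop_iff[OF P1 \<kappa>1] by blast
      then show ?thesis
        using 0 by (simp add: x_eq \<xi>_eq zero_append_zero)
    qed simp
  qed
  then show ?thesis
    unfolding hurwitz_closed_loop_iff[OF P \<kappa>] by blast
qed

section \<open>Weak resilience of the compensated network\<close>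

theorem proposition1:
  fixes n1 n2 p1 p2 m1 m2 q1 q2 p :: nat
    and A1 J1 B1 S1 C1 A2 J2 B2 S2 C2 A B C S R \<Theta> \<Lambda> \<Gamma> \<Xi> :: "real mat"
  assumes "A1 \<in> carrier_mat n1 n1" and "J1 \<in> carrier_mat n1 p2" and "B1 \<in> carrier_mat n1 m1"
    and "S1 \<in> carrier_mat p1 n1" and "C1 \<in> carrier_mat q1 n1"
    and "A2 \<in> carrier_mat n2 n2" and "J2 \<in> carrier_mat n2 p1" and "B2 \<in> carrier_mat n2 m2"
    and "S2 \<in> carrier_mat p2 n2" and "C2 \<in> carrier_mat q2 n2"
    and "R \<in> carrier_mat (n1 + n2) p" and "\<Theta> \<in> carrier_mat p (n1 + n2)"
    and "A = four_block_mat A1 (J1 * S2) (J2 * S1) A2"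
    and "B = four_block_mat B1 (0\<^sub>m n1 m2) (0\<^sub>m n2 m1) B2"
    and "C = four_block_mat C1 (0\<^sub>m q1 n2) (0\<^sub>m q2 n1) C2"
    and "S = four_block_mat S1 (0\<^sub>m p1 n2) (0\<^sub>m p2 n1) S2"
    and "controllable A R"
    and "hurwitz (A + R * \<Theta>)"
    and "\<Lambda> = four_block_mat A1 (J1 * S2) (0\<^sub>m n2 n1) A2 + R * \<Theta>"
    and "\<Gamma> = four_block_mat (0\<^sub>m n1 p1) (0\<^sub>m n1 p2) J2 (0\<^sub>m n2 p2)"
    and "\<Xi> = - four_block_mat C1 (0\<^sub>m q1 n2) (0\<^sub>m q2 n1) C2"
  shows "weakly_resilient
           \<lparr>sub_A = A1, sub_J = J1, sub_B = B1, sub_S = S1, sub_C = C1\<rparr>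
           \<lparr>sub_A = A2, sub_J = J2, sub_B = B2, sub_S = S2, sub_C = C2\<rparr>
           (compensated_system
              \<lparr>net_A = A, net_B = B, net_R = R, net_C = C, net_S = S\<rparr>
              \<lparr>comp_Lambda = \<Lambda>, comp_Gamma = \<Gamma>, comp_Xi = \<Xi>, comp_Theta = \<Theta>\<rparr>)"
proof -
  let ?\<Sigma>1 = "\<lparr>sub_A = A1, sub_J = J1, sub_B = B1, sub_S = S1, sub_C = C1\<rparr>"
  let ?\<Sigma>2 = "\<lparr>sub_A = A2, sub_J = J2, sub_B = B2, sub_S = S2, sub_C = C2\<rparr>"
  \<comment> \<open>This is \<open>A\<close> with the coupling from the first subsystem into the
    second removed; it is also the part of \<Lambda> that remains without
    \<open>R * \<Theta>\<close>.\<close>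
  define D where "D = four_block_mat A1 (J1 * S2) (0\<^sub>m n2 n1) A2"
  have carriers: "D \<in> carrier_mat (n1 + n2) (n1 + n2)" "\<Gamma> * S \<in> carrier_mat (n1 + n2) (n1 + n2)"
    "R * \<Theta> \<in> carrier_mat (n1 + n2) (n1 + n2)" "B \<in> carrier_mat (n1 + n2) (m1 + m2)"
    "C \<in> carrier_mat (q1 + q2) (n1 + n2)"
    using assms by (auto simp: D_def)
  have B_diag: "B = block_diag B1 B2" and C_diag: "C = block_diag C1 C2"
    using assms by (auto simp: block_diag_def)
  have JS: "J1 * S2 \<in> carrier_mat n1 n2" "J2 * S1 \<in> carrier_mat n2 n1"
    using assms by auto
  have "\<Gamma> * S = four_block_mat
      (0\<^sub>m n1 p1 * S1 + 0\<^sub>m n1 p2 * 0\<^sub>m p2 n1) (0\<^sub>m n1 p1 * 0\<^sub>m p1 n2 + 0\<^sub>m n1 p2 * S2)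
      (J2 * S1 + 0\<^sub>m n2 p2 * 0\<^sub>m p2 n1) (J2 * 0\<^sub>m p1 n2 + 0\<^sub>m n2 p2 * S2)"
    unfolding \<open>\<Gamma> = _\<close> \<open>S = _\<close>
    by (rule mult_four_block_mat[of _ n1 p1 _ p2 _ n2 _ _ n1 _ n2]) (use assms in auto)
  also have "\<dots> = four_block_mat (0\<^sub>m n1 n1) (0\<^sub>m n1 n2) (J2 * S1) (0\<^sub>m n2 n2)"
    using assms JS by simp
  finally have \<Gamma>S: "\<Gamma> * S = \<dots>" .
  \<comment> \<open>The only nonzero block of \<open>\<Gamma> * S\<close> is \<open>J2 * S1\<close>,
    exactly the coupling missing from \<open>D\<close>. Hence
    \<open>D + \<Gamma> * S + R * \<Theta>\<close> is the matrix \<open>A + R * \<Theta>\<close>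
    assumed to be Hurwitz.\<close>
  have A_eq: "A = D + \<Gamma> * S"
    unfolding \<Gamma>S D_def \<open>A = _\<close> using assms JS
    by (subst add_four_block_mat[of _ n1 n1 _ n2 _ n2]) auto
  have \<Lambda>_eq: "\<Lambda> = D + R * \<Theta>" and \<Xi>_eq: "\<Xi> = - C"
    using assms by (auto simp: D_def)
  show ?thesis
    unfolding weakly_resilient_def
  proof (intro ballI)
    fix \<kappa>1 \<kappa>2
    assume "\<kappa>1 \<in> stabilizing_controllers ?\<Sigma>1" "\<kappa>2 \<in> stabilizing_controllers ?\<Sigma>2"
    then obtain d1 d2 where \<kappa>1: "controller_dims d1 q1 m1 \<kappa>1" and \<kappa>2: "controller_dims d2 q2 m2 \<kappa>2"
      and stable1: "hurwitz (closed_loop \<lparr>plant_A = A1, plant_B = B1, plant_C = C1\<rparr> \<kappa>1)"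
      and stable2: "hurwitz (closed_loop \<lparr>plant_A = A2, plant_B = B2, plant_C = C2\<rparr> \<kappa>2)"
      using assms unfolding stabilizing_controllers_def is_controller_def controller_dims_def
        local_plant_def by auto
    \<comment> \<open>The error loop: \<open>D\<close> is block triangular with coupling
      \<open>J1 * S2\<close>, so stability of the two local loops suffices.\<close>
    have "hurwitz (closed_loop \<lparr>plant_A = D, plant_B = B, plant_C = C\<rparr> (parallel \<kappa>1 \<kappa>2))"
      unfolding D_def B_diag C_diag
      by (rule hurwitz_cascade_closed_loop[OF \<open>A1 \<in> _\<close> JS(1) \<open>A2 \<in> _\<close> \<open>B1 \<in> _\<close> \<open>B2 \<in> _\<close>
            \<open>C1 \<in> _\<close> \<open>C2 \<in> _\<close> \<kappa>1 \<kappa>2 stable1 stable2])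
    then have "hurwitz (closed_loop
      \<lparr>plant_A = four_block_mat (D + R * \<Theta>) (\<Gamma> * S) (R * \<Theta>) (D + \<Gamma> * S),
       plant_B = 0\<^sub>m (n1 + n2) (m1 + m2) @\<^sub>r B, plant_C = block_row (- C) C\<rparr> (parallel \<kappa>1 \<kappa>2))"
      using \<open>hurwitz (A + R * \<Theta>)\<close> unfolding A_eq
      by (intro hurwitz_compensated_closed_loop[OF carriers parallel_dims[OF \<kappa>1 \<kappa>2]])
    \<comment> \<open>These dimensions identify the zero block in \<open>plant_B\<close> of
      \<open>compensated_system\<close>, whose size is computed from \<Lambda> and
      \<open>B\<close>.\<close>
    moreover have "dim_row (D + R * \<Theta>) = n1 + n2" "dim_col B = m1 + m2"
      using carriers by auto
    ultimately show "hurwitz (closed_loop (compensated_system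
        \<lparr>net_A = A, net_B = B, net_R = R, net_C = C, net_S = S\<rparr>
        \<lparr>comp_Lambda = \<Lambda>, comp_Gamma = \<Gamma>, comp_Xi = \<Xi>, comp_Theta = \<Theta>\<rparr>) (parallel \<kappa>1 \<kappa>2))"
      by (simp add: compensated_system_def A_eq \<Lambda>_eq \<Xi>_eq)
  qed
qed

end
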